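(* Let $S=\{(x_1,x_2,x_3,x_4)\in\mathbb{R}^4 : x_1=x_2^2+x_3^2-x_4^2\}$. For each positive integer $k$ and each $\alpha>0$, there exist a set $P$ of $m=\Theta(k^{3+3\alpha})$ points contained in $S$ and a set $L$ of $n=\Theta(k^{2+4\alpha})$ lines, each fully contained in $S$, such that (i) at most $O(1)$ lines of $L$ lie in any common 2-flat, (ii) at most $O(k^{1+3\alpha})$ lines of $L$ lie in any common hyperplane, and (iii) $I(P,L)=\Theta(k^{3+4\alpha})$.
   Context: For a finite set $P$ of points and a finite set $L$ of lines in $\mathbb{R}^4$, $I(P,L)$ denotes the number of incidences, i.e. the number of pairs $(p,\ell)\in P\times L$ with $p\in\ell$. A 2-flat is a 2-dimensional affine subspace of $\mathbb{R}^4$, and a hyperplane is a 3-dimensional affine subspace. The asymptotic notation $O,\Theta$ refers to $k\to\infty$, with implied constants independent of $k$ (they may depend on $\alpha$). *)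

theory Defs
  imports "HOL-Analysis.Analysis" "HOL-Library.Landau_Symbols"
begin

text \<open>In the index type \<open>4\<close> the numeral \<open>4\<close> denotes the same element as \<open>0\<close>, so
  \<open>x $ 1, x $ 2, x $ 3, x $ 4\<close> are the four distinct coordinates of \<open>x\<close>.\<close>

definition quadric_S :: "(real ^ 4) set" where
  "quadric_S = {x. x $ 1 = (x $ 2)\<^sup>2 + (x $ 3)\<^sup>2 - (x $ 4)\<^sup>2}"

definition is_flat :: "nat \<Rightarrow> (real ^ 4) set \<Rightarrow> bool" where
  "is_flat d F \<longleftrightarrow> affine F \<and> aff_dim F = int d"

abbreviation is_line :: "(real ^ 4) set \<Rightarrow> bool" where
  "is_line \<equiv> is_flat 1"

abbreviation is_hyperplane :: "(real ^ 4) set \<Rightarrow> bool" where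
  "is_hyperplane \<equiv> is_flat 3"

definition incidences :: "(real ^ 4) set \<Rightarrow> (real ^ 4) set set \<Rightarrow> nat" where
  "incidences P L = card {(p, l). p \<in> P \<and> l \<in> L \<and> p \<in> l}"

end

theory Submission
  imports Defs
begin

text \<open>
  In the coordinates \<open>u = x\<^sub>2 - x\<^sub>4\<close>, \<open>w = x\<^sub>2 + x\<^sub>4\<close>, \<open>y = x\<^sub>3\<close> the quadric is the graph
  \<open>x\<^sub>1 = u w + y\<^sup>2\<close>, and a line in \<open>(u, w, y)\<close>-space lifts to a line of the quadric as soon as its
  direction is null for \<open>u w + y\<^sup>2\<close>. The directions \<open>(1, -t\<^sup>2, t)\<close> are null, so with
  \<open>T = \<lfloor>k\<^sup>\<alpha>\<rfloor>\<close> one takes the lines through \<open>(0, w, y)\<close> in these directions for integers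
  \<open>0 \<le> t < T\<close>, \<open>0 \<le> w < k T\<^sup>2\<close>, \<open>0 \<le> y < k T\<close>. Their points with \<open>u = 0, \<dots>, k - 1\<close> all lie
  in an integer box of size \<open>k \<times> 2 k T\<^sup>2 \<times> 2 k T\<close>, so every line has exactly \<open>k\<close> incidences
  with that box.

  A hyperplane imposes two equations on \<open>(t, w, y)\<close>, which determine \<open>w\<close> from \<open>(t, y)\<close> or
  \<open>y\<close> from \<open>(t, w)\<close>. In a 2-flat, both \<open>(t, t\<^sup>2)\<close> and \<open>(y, y\<^sup>2)\<close> are confined to a line meeting
  a parabola, so \<open>t\<close> and \<open>y\<close> take at most two values each, and they determine \<open>w\<close>.
\<close>

section \<open>Null coordinates on four-space\<close>

definition null_pt :: "real \<Rightarrow> real \<Rightarrow> real \<Rightarrow> real \<Rightarrow> real ^ 4" where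
  "null_pt x u w y = (\<chi> i. if i = 1 then x else if i = 2 then (w + u) / 2
     else if i = 3 then y else (w - u) / 2)"

lemma null_pt_nth [simp]:
  "null_pt x u w y $ 1 = x" "null_pt x u w y $ 2 = (w + u) / 2"
  "null_pt x u w y $ 3 = y" "null_pt x u w y $ 4 = (w - u) / 2"
  by (simp_all add: null_pt_def)

lemma null_pt_eq_iff [simp]:
  "null_pt x u w y = null_pt x' u' w' y' \<longleftrightarrow> x = x' \<and> u = u' \<and> w = w' \<and> y = y'"
  by (auto simp: vec_eq_iff forall_4 field_simps)

lemma null_pt_surj: "\<exists>x u w y. v = null_pt x u w y"
  by (rule exI[of _ "v $ 1"], rule exI[of _ "v $ 2 - v $ 4"], rule exI[of _ "v $ 2 + v $ 4"],
      rule exI[of _ "v $ 3"]) (simp add: vec_eq_iff forall_4 field_simps)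

lemma null_pt_add:
  "null_pt x u w y + null_pt x' u' w' y' = null_pt (x + x') (u + u') (w + w') (y + y')"
  by (simp add: vec_eq_iff forall_4 field_simps)

lemma null_pt_scaleR: "c *\<^sub>R null_pt x u w y = null_pt (c * x) (c * u) (c * w) (c * y)"
  by (simp add: vec_eq_iff forall_4 field_simps)

lemma null_pt_zero: "0 = null_pt 0 0 0 0"
  by (simp add: vec_eq_iff forall_4)

lemma inner_null_pt:
  "a \<bullet> null_pt x u w y = a $ 1 * x + (a $ 2 - a $ 4) / 2 * u + (a $ 2 + a $ 4) / 2 * w + a $ 3 * y"
  by (simp add: inner_vec_def sum_4 field_simps)

lemma null_pt_mem_quadric_S: "null_pt x u w y \<in> quadric_S \<longleftrightarrow> x = u * w + y\<^sup>2"
proof -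
  have "((w + u) / 2)\<^sup>2 - ((w - u) / 2)\<^sup>2 = u * w"
    by (simp add: power2_eq_square field_simps)
  then show ?thesis
    by (auto simp: quadric_S_def)
qed

section \<open>Lines of the quadric in null directions\<close>

text \<open>The first coordinate is the value of \<open>u w + y\<^sup>2\<close> along \<open>(0, w, y) + s (1, -t\<^sup>2, t)\<close>, whose
  quadratic terms in \<open>s\<close> cancel.\<close>

definition null_line :: "real \<times> real \<times> real \<Rightarrow> (real ^ 4) set" where
  "null_line = (\<lambda>(t, w, y). range (\<lambda>s. null_pt (y\<^sup>2) 0 w y + s *\<^sub>R null_pt (w + 2 * y * t) 1 (- t\<^sup>2) t))"

lemma null_line_mem_iff:
  "null_pt x u w' y' \<in> null_line (t, w, y) \<longleftrightarrow>
     x = y\<^sup>2 + u * (w + 2 * y * t) \<and> w' = w - u * t\<^sup>2 \<and> y' = y + u * t"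
  by (auto simp: null_line_def null_pt_add null_pt_scaleR)

lemma is_line_null_line: "is_line (null_line q)"
proof -
  obtain t w y where q: "q = (t, w, y)" by (cases q)
  define p where "p = null_pt (y\<^sup>2) 0 w y"
  define d where "d = null_pt (w + 2 * y * t) 1 (- t\<^sup>2) t"
  have "null_line q = affine hull {p, p + d}"
    by (simp add: q null_line_def affine_hull_2_alt p_def d_def)
  moreover have "d \<noteq> 0"
    by (simp add: d_def null_pt_zero)
  ultimately show ?thesis
    by (simp add: is_flat_def aff_dim_2)
qed

lemma null_line_subset_quadric_S: "null_line q \<subseteq> quadric_S"
  by (cases q) (auto simp: null_line_def null_pt_add null_pt_scaleR null_pt_mem_quadric_S
      power2_eq_square algebra_simps)

text \<open>The point with \<open>u = 0\<close> recovers \<open>w\<close> and \<open>y\<close>; the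
  point with \<open>u = 1\<close> then recovers \<open>t\<close>.\<close>

lemma inj_null_line: "inj null_line"
proof (rule injI)
  fix q q' assume eq: "null_line q = null_line q'"
  obtain t w y t' w' y' where q: "q = (t, w, y)" "q' = (t', w', y')" by (cases q, cases q')
  have *: "null_pt (y\<^sup>2 + u * (w + 2 * y * t)) u (w - u * t\<^sup>2) (y + u * t) \<in> null_line q'" for u
    unfolding eq[symmetric] unfolding q null_line_mem_iff by simp
  show "q = q'"
    using *[of 0] *[of 1] by (simp add: q null_line_mem_iff)
qed

section \<open>Lines in a common hyperplane\<close>

text \<open>Along the line, \<open>a \<bullet> x\<close> is an affine function of the parameter
  \<open>s\<close>: the first equation is its constant term, the second says that its slope
  vanishes.\<close>

lemma null_line_subset_hyperplane_iff:
  "null_line (t, w, y) \<subseteq> {x. a \<bullet> x = b} \<longleftrightarrow>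
     a $ 1 * y\<^sup>2 + (a $ 2 + a $ 4) / 2 * w + a $ 3 * y = b \<and>
     a $ 1 * (w + 2 * y * t) + (a $ 2 - a $ 4) / 2 - (a $ 2 + a $ 4) / 2 * t\<^sup>2 + a $ 3 * t = 0"
  (is "?L \<longleftrightarrow> ?A = b \<and> ?B = 0")
proof -
  have "?L \<longleftrightarrow> (\<forall>s. ?A + s * ?B = b)"
    by (auto simp: null_line_def inner_add_right inner_scaleR_right inner_null_pt image_subset_iff)
  also have "\<dots> \<longleftrightarrow> ?A = b \<and> ?B = 0"
    by (metis add.right_neutral add_cancel_left_right mult_1 mult_zero_left mult_zero_right)
  finally show ?thesis .
qed

text \<open>The indices of the lines in \<open>H\<close> project injectively to
  \<open>(t, w)\<close> or to \<open>(t, y)\<close>; since \<open>card C \<le> card B\<close>, one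
  bound covers both cases.\<close>

lemma card_null_lines_in_hyperplane_le:
  assumes H: "is_hyperplane H" and fin: "finite A" "finite B" "finite C" and le: "card C \<le> card B"
  shows "card {l \<in> null_line ` (A \<times> B \<times> C). l \<subseteq> H} \<le> card A * card B"
proof -
  obtain a b where "a \<noteq> 0" and Hab: "H = {x. a \<bullet> x = b}"
  proof -
    have "aff_dim H = int (DIM(real ^ 4) - 1)"
      using H by (simp add: is_flat_def)
    from iffD1[OF aff_dim_eq_hyperplane this]
    obtain a b where "a \<noteq> 0" "affine hull H = {x. a \<bullet> x = b}"
      by (elim exE conjE)
    moreover have "affine hull H = H"
      using H by (simp add: is_flat_def)
    ultimately show thesis
      using that by simp
  qed
  define Q where "Q = {q \<in> A \<times> B \<times> C. null_line q \<subseteq> H}"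
  have Q: "{l \<in> null_line ` (A \<times> B \<times> C). l \<subseteq> H} = null_line ` Q"
    by (auto simp: Q_def)
  have eqs: "a $ 1 * y\<^sup>2 + (a $ 2 + a $ 4) / 2 * w + a $ 3 * y = b"
    "a $ 1 * (w + 2 * y * t) + (a $ 2 - a $ 4) / 2 - (a $ 2 + a $ 4) / 2 * t\<^sup>2 + a $ 3 * t = 0"
    if "(t, w, y) \<in> Q" for t w y
    using that unfolding Q_def Hab by (simp_all add: null_line_subset_hyperplane_iff)
  have "card Q \<le> card A * card B"
  \<comment> \<open>If both coefficients vanish, the first equation reads
    \<open>a $ 3 * y = b\<close> and fixes \<open>y\<close>. Otherwise \<open>w\<close> is fixed by
    the first equation when \<open>a $ 2 + a $ 4\<close> is nonzero, and by the second when
    \<open>a $ 1\<close> is.\<close>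
  proof (cases "a $ 1 = 0 \<and> a $ 2 + a $ 4 = 0")
    case True
    have a3: "a $ 3 \<noteq> 0" if "(t, w, y) \<in> Q" for t w y
    proof
      assume "a $ 3 = 0"
      with True eqs(2)[OF that] have "a $ 1 = 0" "a $ 2 = 0" "a $ 3 = 0" "a $ 4 = 0"
        by simp_all
      with \<open>a \<noteq> 0\<close> show False by (simp add: vec_eq_iff forall_4)
    qed
    have "y = y'" if "(t, w, y) \<in> Q" "(t, w, y') \<in> Q" for t w y y'
    proof -
      have "a $ 3 * y = a $ 3 * y'"
        using True eqs(1)[OF that(1)] eqs(1)[OF that(2)] by simp
      with a3[OF that(1)] show ?thesis by simp
    qed
    then have "inj_on (\<lambda>(t, w, y). (t, w)) Q"
      by (auto intro!: inj_onI)
    then have "card Q \<le> card (A \<times> B)"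
      by (rule card_inj_on_le) (auto simp: Q_def fin)
    then show ?thesis by (simp add: card_cartesian_product)
  next
    case False
    have "w = w'" if "(t, w, y) \<in> Q" "(t, w', y) \<in> Q" for t w w' y
    proof -
      have "(a $ 2 + a $ 4) / 2 * w = (a $ 2 + a $ 4) / 2 * w'"
        "a $ 1 * (w + 2 * y * t) = a $ 1 * (w' + 2 * y * t)"
        using eqs[OF that(1)] eqs[OF that(2)] by linarith+
      with False show ?thesis by auto
    qed
    then have "inj_on (\<lambda>(t, w, y). (t, y)) Q"
      by (auto intro!: inj_onI)
    then have "card Q \<le> card (A \<times> C)"
      by (rule card_inj_on_le) (auto simp: Q_def fin)
    also have "\<dots> \<le> card A * card B"
      using le by (simp add: card_cartesian_product)
    finally show ?thesis .
  qed
  then show ?thesis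
    unfolding Q using card_image_le[of Q null_line] fin by (simp add: Q_def)
qed

section \<open>Lines in a common 2-flat\<close>

text \<open>Translation by \<open>-p\<close> turns \<open>F\<close> into a plane through the origin
  containing \<open>d\<close>; a basis extending \<open>{d}\<close> has exactly one further vector
  \<open>e\<close>.\<close>

lemma flat_2_containing_line:
  assumes F: "is_flat 2 F" and p: "p \<in> F" "p + d \<in> F" and d: "d \<noteq> 0"
  obtains e where "F \<subseteq> {p + a *\<^sub>R d + b *\<^sub>R e |a b. True}"
proof -
  define V where "V = (\<lambda>x. x - p) ` F"
  have V: "subspace V"
    using affine_diffs_subspace_subtract[of F p] F p by (simp add: V_def is_flat_def)
  have "aff_dim V = 2"
    using F aff_dim_translation_eq_subtract[of p F] by (simp add: V_def is_flat_def)
  then have dimV: "dim V = 2"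
    using aff_dim_subspace[OF V] by simp
  have dV: "{d} \<subseteq> V"
    using p by (force simp: V_def)
  obtain B where B: "{d} \<subseteq> B" "B \<subseteq> V" "independent B" "V \<subseteq> span B"
    using maximal_independent_subset_extend[OF dV] d by auto
  have "card B = 2"
    using basis_card_eq_dim[OF B(2) B(4) B(3)] dimV by simp
  then obtain e where Bde: "B = {d, e}"
    using B(1) by (auto simp: card_2_iff)
  have "F \<subseteq> {p + a *\<^sub>R d + b *\<^sub>R e |a b. True}"
  proof
    fix x assume "x \<in> F"
    then have "x - p \<in> span {d, e}"
      using B(4) by (auto simp: V_def Bde)
    then obtain a b where "x - p - a *\<^sub>R d = b *\<^sub>R e"
      by (auto simp: span_breakdown_eq)
    then have "x = p + a *\<^sub>R d + b *\<^sub>R e"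
      by (simp add: algebra_simps)
    then show "x \<in> {p + a *\<^sub>R d + b *\<^sub>R e |a b. True}" by blast
  qed
  then show thesis by (rule that)
qed

text \<open>The chord of the parabola between the points over \<open>t0\<close> and \<open>t\<close>
  has slope \<open>t0 + t\<close>, which must equal the slope \<open>c / e\<close> of the given line
  unless \<open>t = t0\<close>.\<close>

lemma quadratic_chord_endpoints:
  fixes t t0 b c e :: real
  assumes "t = t0 + b * e" "t\<^sup>2 = t0\<^sup>2 + b * c"
  shows "t \<in> {t0, c / e - t0}"
proof (cases "b * e = 0")
  case False
  then have "(t + t0) * (b * e) = b * c"
    using assms by (simp add: power2_eq_square algebra_simps)
  with False have "t + t0 = c / e"
    by (simp add: eq_divide_eq)
  then show ?thesis by auto
qed (use assms in auto)

lemma card_null_lines_in_flat_2_le: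
  assumes F: "is_flat 2 F" and fin: "finite A"
  shows "card {l \<in> null_line ` A. l \<subseteq> F} \<le> 4"
proof -
  define Q where "Q = {q \<in> A. null_line q \<subseteq> F}"
  have Q: "{l \<in> null_line ` A. l \<subseteq> F} = null_line ` Q"
    by (auto simp: Q_def)
  have "card Q \<le> 4"
  proof (cases "Q = {}")
    case False
    then obtain t0 w0 y0 where q0: "(t0, w0, y0) \<in> Q" by auto
    define p where "p = null_pt (y0\<^sup>2) 0 w0 y0"
    define d where "d = null_pt (w0 + 2 * y0 * t0) 1 (- t0\<^sup>2) t0"
    have mem: "null_pt (y\<^sup>2 + u * (w + 2 * y * t)) u (w - u * t\<^sup>2) (y + u * t) \<in> F"
      if "(t, w, y) \<in> Q" for t w y u
      using that by (auto simp: Q_def null_line_mem_iff)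
    have "p \<in> F" "p + d \<in> F"
      using mem[OF q0, of 0] mem[OF q0, of 1] by (simp_all add: p_def d_def null_pt_add)
    moreover have "d \<noteq> 0" by (simp add: d_def null_pt_zero)
    ultimately obtain e where e: "F \<subseteq> {p + a *\<^sub>R d + b *\<^sub>R e |a b. True}"
      using flat_2_containing_line[OF F] by blast
    obtain e1 eu ew ey where e_eq: "e = null_pt e1 eu ew ey"
      using null_pt_surj by blast
    \<comment> \<open>the remaining coordinates of \<open>e - eu *\<^sub>R d\<close>, whose \<open>u\<close>-coordinate vanishes\<close>
    define f1 fw fy where f_def: "f1 = e1 - eu * (w0 + 2 * y0 * t0)"
      "fw = ew + eu * t0\<^sup>2" "fy = ey - eu * t0"
    \<comment> \<open>As \<open>d\<close> has \<open>u\<close>-coordinate 1, fixing \<open>u\<close>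
      eliminates \<open>a\<close>: each slice of \<open>F\<close> at constant \<open>u\<close> lies
      in a line of direction \<open>(f1, fw, fy)\<close>.\<close>
    have F_eq: "\<exists>b. x = y0\<^sup>2 + u * (w0 + 2 * y0 * t0) + b * f1 \<and> w = w0 - u * t0\<^sup>2 + b * fw \<and>
        y = y0 + u * t0 + b * fy" if x: "null_pt x u w y \<in> F" for x u w y
    proof -
      obtain a b where "null_pt x u w y = p + a *\<^sub>R d + b *\<^sub>R e"
        using e x by blast
      then have *: "x = y0\<^sup>2 + a * (w0 + 2 * y0 * t0) + b * e1" "u = a + b * eu"
         "w = w0 - a * t0\<^sup>2 + b * ew" "y = y0 + a * t0 + b * ey"
        by (simp_all add: p_def d_def e_eq null_pt_add null_pt_scaleR)
      show ?thesis
        by (rule exI[of _ b]) (unfold * f_def, simp add: algebra_simps)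
    qed
    \<comment> \<open>The slice \<open>u = 0\<close> constrains the base point of the line; the
      difference from the slice \<open>u = 1\<close> constrains its direction. This puts
      \<open>(y, y\<^sup>2)\<close> and \<open>(t, t\<^sup>2)\<close> each on a fixed line.\<close>
    have param: "\<exists>b c. y\<^sup>2 = y0\<^sup>2 + b * f1 \<and> w = w0 + b * fw \<and> y = y0 + b * fy \<and>
        w + 2 * y * t = w0 + 2 * y0 * t0 + c * f1 \<and> t\<^sup>2 = t0\<^sup>2 + c * (- fw) \<and> t = t0 + c * fy"
      if q: "(t, w, y) \<in> Q" for t w y
    proof -
      obtain b where b: "y\<^sup>2 = y0\<^sup>2 + b * f1" "w = w0 + b * fw" "y = y0 + b * fy"
        using F_eq[OF mem[OF q, of 0]] by auto
      obtain b' where b': "y\<^sup>2 + (w + 2 * y * t) = y0\<^sup>2 + (w0 + 2 * y0 * t0) + b' * f1"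
        "w - t\<^sup>2 = w0 - t0\<^sup>2 + b' * fw" "y + t = y0 + t0 + b' * fy"
        using F_eq[OF mem[OF q, of 1]] by auto
      show ?thesis
        by (rule exI[of _ b], rule exI[of _ "b' - b"])
          (use b b' in \<open>simp add: left_diff_distrib\<close>)
    qed
    \<comment> \<open>These are the two possible intersections of each line with the parabola. For
      \<open>fy = 0\<close> the quotients are 0, which at most adds the harmless values
      \<open>-t0\<close> and \<open>-y0\<close>.\<close>
    define U where "U = {t0, - fw / fy - t0} \<times> {y0, f1 / fy - y0}"
    have "(t, y) \<in> U" if "(t, w, y) \<in> Q" for t w y
    proof -
      from param[OF that] have "t \<in> {t0, - fw / fy - t0}" "y \<in> {y0, f1 / fy - y0}"
        using quadratic_chord_endpoints by blast+
      then show ?thesis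
        unfolding U_def by (rule SigmaI)
    qed
    then have sub: "(\<lambda>(t, w, y). (t, y)) ` Q \<subseteq> U"
      by auto
    \<comment> \<open>Here \<open>t = t0\<close> and \<open>y = y0\<close>, so \<open>w - w0\<close>
      equals both \<open>b * fw\<close> and \<open>c * f1\<close>. Were it nonzero, all four factors
      would be nonzero, against \<open>b * f1 = 0\<close>.\<close>
    have deg: "w = w0" if q: "(t, w, y) \<in> Q" and fy: "fy = 0" for t w y
    proof -
      obtain b c where bc: "y\<^sup>2 = y0\<^sup>2 + b * f1" "w = w0 + b * fw" "y = y0 + b * fy"
        "w + 2 * y * t = w0 + 2 * y0 * t0 + c * f1" "t\<^sup>2 = t0\<^sup>2 + c * (- fw)" "t = t0 + c * fy"
        using param[OF q] by blast
      with fy have "b * f1 = 0" "w = w0 + c * f1" "c * fw = 0"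
        by simp_all
      with bc(2) show ?thesis by auto
    qed
    have "w = w'" if q: "(t, w, y) \<in> Q" "(t, w', y) \<in> Q" for t w w' y
    proof (cases "fy = 0")
      case True
      then show ?thesis using deg[OF q(1)] deg[OF q(2)] by simp
    next
      case False
      \<comment> \<open>Now \<open>y\<close> determines \<open>b\<close>, and \<open>b\<close>
        determines \<open>w\<close>.\<close>
      then show ?thesis using param[OF q(1)] param[OF q(2)] by auto
    qed
    then have "inj_on (\<lambda>(t, w, y). (t, y)) Q"
      by (auto intro!: inj_onI)
    then have "card Q \<le> card U"
      using sub by (rule card_inj_on_le) (simp add: U_def)
    also have "\<dots> \<le> 2 * 2"
      unfolding U_def card_cartesian_product by (intro mult_mono) (auto simp: card_insert_if)
    finally show ?thesis by simp
  qed simp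
  then show ?thesis
    unfolding Q using card_image_le[of Q null_line] fin by (simp add: Q_def)
qed

section \<open>The grid configuration and its incidences\<close>

text \<open>The box leaves room for the shifts along a line: \<open>w - u * t\<^sup>2\<close> may
  become negative, hence the integer range, and \<open>y + u * t\<close> stays below
  \<open>2 * k * T\<close>.\<close>

definition grid_points :: "nat \<Rightarrow> nat \<Rightarrow> (real ^ 4) set" where
  "grid_points k T = (\<lambda>(u, w, y). null_pt (real u * of_int w + (real y)\<^sup>2) (real u) (of_int w) (real y)) `
     ({..<k} \<times> {- int (k * T\<^sup>2)..<int (k * T\<^sup>2)} \<times> {..<2 * k * T})"

definition grid_lines :: "nat \<Rightarrow> nat \<Rightarrow> (real ^ 4) set set" where
  "grid_lines k T = null_line ` (real ` {..<T} \<times> real ` {..<k * T\<^sup>2} \<times> real ` {..<k * T})"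

lemma card_grid_points: "card (grid_points k T) = 4 * k ^ 3 * T ^ 3"
proof -
  have "card (grid_points k T) =
      card ({..<k} \<times> {- int (k * T\<^sup>2)..<int (k * T\<^sup>2)} \<times> {..<2 * k * T})"
    unfolding grid_points_def by (intro card_image) (auto simp: inj_on_def)
  also have "\<dots> = k * (2 * (k * T\<^sup>2) * (2 * k * T))"
    by (simp add: card_cartesian_product nat_mult_distrib nat_power_eq)
  finally show ?thesis
    by (simp add: power2_eq_square power3_eq_cube)
qed

lemma card_grid_lines: "card (grid_lines k T) = k\<^sup>2 * T ^ 4"
  unfolding grid_lines_def
  by (subst card_image[OF inj_on_subset[OF inj_null_line]])
    (simp_all add: card_cartesian_product card_image power2_eq_square power4_eq_xxxx)

text \<open>Each line has one point on every slice \<open>u = s\<close>, and for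
  \<open>s < k\<close> that point is in the grid, so incidences correspond to quadruples
  \<open>(s, t, w, y)\<close>.\<close>

lemma incidences_grid: "incidences (grid_points k T) (grid_lines k T) = k ^ 3 * T ^ 4"
proof -
  define D where "D = {..<k} \<times> {..<T} \<times> {..<k * T\<^sup>2} \<times> {..<k * T}"
  define f where "f = (\<lambda>(s :: nat, t :: nat, w :: nat, y :: nat).
    (null_pt ((real y)\<^sup>2 + real s * (real w + 2 * real y * real t)) (real s)
       (real w - real s * (real t)\<^sup>2) (real y + real s * real t),
     null_line (real t, real w, real y)))"
  have "{(p, l). p \<in> grid_points k T \<and> l \<in> grid_lines k T \<and> p \<in> l} = f ` D"
  proof (intro equalityI subrelI)
    fix p l assume "(p, l) \<in> {(p, l). p \<in> grid_points k T \<and> l \<in> grid_lines k T \<and> p \<in> l}"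
    then obtain u w' y' t w y where
      "p = null_pt (real u * of_int w' + (real y')\<^sup>2) (real u) (of_int w') (real y')"
      "u < k" "l = null_line (real t, real w, real y)"
      "t < T" "w < k * T\<^sup>2" "y < k * T" "p \<in> l"
      unfolding grid_points_def grid_lines_def by auto
    then have "(p, l) = f (u, t, w, y)" "(u, t, w, y) \<in> D"
      by (auto simp: f_def D_def null_line_mem_iff)
    then show "(p, l) \<in> f ` D" by blast
  next
    fix p l assume "(p, l) \<in> f ` D"
    then obtain s t w y where D: "s < k" "t < T" "w < k * T\<^sup>2" "y < k * T"
      and pl: "(p, l) = f (s, t, w, y)"
      by (auto simp: D_def)
    have st: "s * t\<^sup>2 \<le> k * T\<^sup>2" "s * t \<le> k * T"
      using D by (auto intro!: mult_mono power_mono)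
    have "p = (\<lambda>(u, w, y). null_pt (real u * of_int w + (real y)\<^sup>2) (real u) (of_int w) (real y))
        (s, int w - int (s * t\<^sup>2), y + s * t)"
      using pl by (simp add: f_def power2_eq_square algebra_simps)
    moreover have "(s, int w - int (s * t\<^sup>2), y + s * t) \<in>
        {..<k} \<times> {- int (k * T\<^sup>2)..<int (k * T\<^sup>2)} \<times> {..<2 * k * T}"
      using D st by (simp del: of_nat_mult of_nat_power)
    ultimately have "p \<in> grid_points k T"
      unfolding grid_points_def by (rule image_eqI)
    moreover have "l \<in> grid_lines k T" "p \<in> l"
      using pl D by (auto simp: f_def grid_lines_def null_line_mem_iff)
    ultimately show "(p, l) \<in> {(p, l). p \<in> grid_points k T \<and> l \<in> grid_lines k T \<and> p \<in> l}"
      by simp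
  qed
  \<comment> \<open>The \<open>u\<close>-coordinate of the point recovers \<open>s\<close>; the line
    recovers \<open>(t, w, y)\<close>.\<close>
  moreover have "inj_on f D"
    by (auto simp: inj_on_def f_def dest: injD[OF inj_null_line])
  ultimately have "incidences (grid_points k T) (grid_lines k T) = card D"
    by (simp add: incidences_def card_image)
  then show ?thesis
    by (simp add: D_def card_cartesian_product eval_nat_numeral)
qed

section \<open>Asymptotics and choice of parameters\<close>

lemma bigtheta_mult_power_floor_powr:
  fixes \<alpha> c :: real
  assumes "\<alpha> > 0" "c \<noteq> 0"
  shows "(\<lambda>k. c * real k ^ i * real (nat \<lfloor>real k powr \<alpha>\<rfloor>) ^ j)
    \<in> \<Theta>(\<lambda>k. real k powr (real i + real j * \<alpha>))"
proof -
  have "(\<lambda>k. real (nat \<lfloor>real k powr \<alpha>\<rfloor>)) \<in> \<Theta>(\<lambda>k. real k powr \<alpha>)"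
  \<comment> \<open>For \<open>x \<ge> 1\<close> the floor is at least 1, so \<open>x\<close> is
    less than the floor plus 1, hence less than twice the floor; this gives the constant
    1/2.\<close>
  proof (rule bigthetaI'[where ?c1.0 = "1/2" and ?c2.0 = 1])
    show "eventually (\<lambda>k. 1 / 2 * norm (real k powr \<alpha>) \<le> norm (real (nat \<lfloor>real k powr \<alpha>\<rfloor>)) \<and>
        norm (real (nat \<lfloor>real k powr \<alpha>\<rfloor>)) \<le> 1 * norm (real k powr \<alpha>)) sequentially"
      using eventually_gt_at_top[of 0]
    proof eventually_elim
      case (elim k)
      then have "real k powr \<alpha> \<ge> 1"
        using assms by (simp add: ge_one_powr_ge_zero)
      then have "\<lfloor>real k powr \<alpha>\<rfloor> \<ge> 1" by simp
      then have "of_int \<lfloor>real k powr \<alpha>\<rfloor> \<ge> (1 :: real)"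
        "real (nat \<lfloor>real k powr \<alpha>\<rfloor>) = of_int \<lfloor>real k powr \<alpha>\<rfloor>"
        by linarith+
      moreover have "real k powr \<alpha> < of_int \<lfloor>real k powr \<alpha>\<rfloor> + 1" "of_int \<lfloor>real k powr \<alpha>\<rfloor> \<le> real k powr \<alpha>"
        by linarith+
      moreover have "norm (real k powr \<alpha>) = real k powr \<alpha>"
        "norm (real (nat \<lfloor>real k powr \<alpha>\<rfloor>)) = real (nat \<lfloor>real k powr \<alpha>\<rfloor>)"
        by simp_all
      ultimately show ?case by linarith
    qed
  qed auto
  then have "(\<lambda>k. real (nat \<lfloor>real k powr \<alpha>\<rfloor>) ^ j) \<in> \<Theta>(\<lambda>k. (real k powr \<alpha>) ^ j)"
    by (induction j) (simp_all only: power_0 power_Suc bigtheta_refl landau_theta.mult)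
  then have "(\<lambda>k. c * real k ^ i * real (nat \<lfloor>real k powr \<alpha>\<rfloor>) ^ j)
      \<in> \<Theta>(\<lambda>k. real k ^ i * (real k powr \<alpha>) ^ j)"
    using assms by (intro landau_theta.mult) auto
  also have "(\<lambda>k. real k ^ i * (real k powr \<alpha>) ^ j) \<in> \<Theta>(\<lambda>k. real k powr (real i + real j * \<alpha>))"
  \<comment> \<open>The identity is only eventual: at \<open>k = 0\<close> the right side is 0,
    while \<open>0 ^ 0 = 1\<close>.\<close>
  proof (rule bigthetaI_cong)
    show "eventually (\<lambda>k. real k ^ i * (real k powr \<alpha>) ^ j = real k powr (real i + real j * \<alpha>)) sequentially"
      using eventually_gt_at_top[of 0]
      by eventually_elim (simp add: powr_add powr_realpow powr_power mult.commute)
  qed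
  finally show ?thesis .
qed

theorem theorem1p3:
  fixes \<alpha> :: real
  assumes "\<alpha> > 0"
  shows "\<exists>(P :: nat \<Rightarrow> (real ^ 4) set) (L :: nat \<Rightarrow> (real ^ 4) set set).
    (\<forall>k>0. finite (P k) \<and> P k \<subseteq> quadric_S) \<and>
    (\<forall>k>0. finite (L k) \<and> (\<forall>l \<in> L k. is_line l \<and> l \<subseteq> quadric_S)) \<and>
    (\<lambda>k. real (card (P k))) \<in> \<Theta>(\<lambda>k. real k powr (3 + 3 * \<alpha>)) \<and>
    (\<lambda>k. real (card (L k))) \<in> \<Theta>(\<lambda>k. real k powr (2 + 4 * \<alpha>)) \<and>
    (\<exists>g :: nat \<Rightarrow> real. g \<in> O(\<lambda>k. 1) \<and>
      (\<forall>k>0. \<forall>F. is_flat 2 F \<longrightarrow> real (card {l \<in> L k. l \<subseteq> F}) \<le> g k)) \<and>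
    (\<exists>h :: nat \<Rightarrow> real. h \<in> O(\<lambda>k. real k powr (1 + 3 * \<alpha>)) \<and>
      (\<forall>k>0. \<forall>H. is_hyperplane H \<longrightarrow> real (card {l \<in> L k. l \<subseteq> H}) \<le> h k)) \<and>
    (\<lambda>k. real (incidences (P k) (L k))) \<in> \<Theta>(\<lambda>k. real k powr (3 + 4 * \<alpha>))"
proof -
  define T where "T k = nat \<lfloor>real k powr \<alpha>\<rfloor>" for k :: nat
  define P where "P = (\<lambda>k. grid_points k (T k))"
  define L where "L = (\<lambda>k. grid_lines k (T k))"
  \<comment> \<open>Every count below is a constant times \<open>k ^ i * T k ^ j\<close>, of order
    \<open>k\<close> to the power \<open>i + j * \<alpha>\<close>.\<close>
  note theta = bigtheta_mult_power_floor_powr[OF assms, folded T_def]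
  have flat: "real (card {l \<in> L k. l \<subseteq> F}) \<le> 4" if "is_flat 2 F" for k F
    using card_null_lines_in_flat_2_le[OF that] by (simp add: L_def grid_lines_def)
  have hyp: "real (card {l \<in> L k. l \<subseteq> H}) \<le> 1 * real k ^ 1 * real (T k) ^ 3"
    if "is_hyperplane H" for k H
  proof -
    \<comment> \<open>The range of \<open>y\<close> is no larger than that of \<open>w\<close>, as
      the hyperplane bound requires; this includes \<open>T k = 0\<close>.\<close>
    have "k * T k \<le> k * (T k)\<^sup>2"
      by (simp add: power2_eq_square)
    then have "card {l \<in> L k. l \<subseteq> H} \<le> T k * (k * (T k)\<^sup>2)"
      using card_null_lines_in_hyperplane_le[OF that, of "real ` {..<T k}"
          "real ` {..<k * (T k)\<^sup>2}" "real ` {..<k * T k}"]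
      by (simp add: L_def grid_lines_def card_image)
    then have "real (card {l \<in> L k. l \<subseteq> H}) \<le> real (T k * (k * (T k)\<^sup>2))"
      by (rule of_nat_mono)
    then show ?thesis
      by (simp add: power2_eq_square power3_eq_cube mult_ac)
  qed
  show ?thesis
  proof (rule exI[of _ P], rule exI[of _ L], intro conjI)
    show "\<forall>k>0. finite (P k) \<and> P k \<subseteq> quadric_S"
      by (auto simp: P_def grid_points_def null_pt_mem_quadric_S)
    show "\<forall>k>0. finite (L k) \<and> (\<forall>l \<in> L k. is_line l \<and> l \<subseteq> quadric_S)"
      using is_line_null_line null_line_subset_quadric_S by (auto simp: L_def grid_lines_def)
    show "(\<lambda>k. real (card (P k))) \<in> \<Theta>(\<lambda>k. real k powr (3 + 3 * \<alpha>))"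
      using theta[of 4 3 3] by (simp add: P_def card_grid_points)
    show "(\<lambda>k. real (card (L k))) \<in> \<Theta>(\<lambda>k. real k powr (2 + 4 * \<alpha>))"
      using theta[of 1 2 4] by (simp add: L_def card_grid_lines)
    show "(\<lambda>k. real (incidences (P k) (L k))) \<in> \<Theta>(\<lambda>k. real k powr (3 + 4 * \<alpha>))"
      using theta[of 1 3 4] by (simp add: P_def L_def incidences_grid)
    show "\<exists>g :: nat \<Rightarrow> real. g \<in> O(\<lambda>k. 1) \<and>
      (\<forall>k>0. \<forall>F. is_flat 2 F \<longrightarrow> real (card {l \<in> L k. l \<subseteq> F}) \<le> g k)"
      using flat by (intro exI[of _ "\<lambda>_. 4"]) auto
    show "\<exists>h :: nat \<Rightarrow> real. h \<in> O(\<lambda>k. real k powr (1 + 3 * \<alpha>)) \<and>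
      (\<forall>k>0. \<forall>H. is_hyperplane H \<longrightarrow> real (card {l \<in> L k. l \<subseteq> H}) \<le> h k)"
      using hyp theta[of 1 1 3]
      by (intro exI[of _ "\<lambda>k. 1 * real k ^ 1 * real (T k) ^ 3"]) (auto dest: bigthetaD1)
  qed
qed

end
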